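(* For all integers $n\ge 1$ and $k$, $$\frac{1}{(2n)!}\sum_{m=0}^n\left[ {n \atop m} \right]_2\mathfrak B_{2m}^{(k)}=\frac{1}{(2n+1)^k}\qquad\text{and}\qquad\sum_{m=0}^n\left\{ {n \atop m} \right\}_2 4^{n-m}\mathfrak C_{2m}^{(k)}=\frac{1}{(2n+1)^k}.$$
   Context: The Stirling numbers of the first kind with level $2$ are defined by $\left[ {n \atop k} \right]_2=\left[ {n-1 \atop k-1} \right]_2+(n-1)^2\left[ {n-1 \atop k} \right]_2$, and those of the second kind with level $2$ by $\left\{ {n \atop k} \right\}_2=\left\{ {n-1 \atop k-1} \right\}_2+k^2\left\{ {n-1 \atop k} \right\}_2$, both with initial values $1$ at $(0,0)$ and $0$ at $(n,0)$ and $(0,n)$ for $n\ge1$. For an integer $k$, the poly-Bernoulli numbers with level $2$ are defined by $\sum_{n\ge0}\mathfrak B_n^{(k)}\frac{x^n}{n!}=\frac{{\rm Li}_{2,k}(2\sin(x/2))}{2\sin(x/2)}$ with ${\rm Li}_{2,k}(z)=\sum_{n\ge0}\frac{z^{2n+1}}{(2n+1)^k}$, and the poly-Cauchy numbers with level $2$ by $\sum_{n\ge0}\mathfrak C_n^{(k)}\frac{x^n}{n!}={\rm Lif}_{2,k}({\rm arcsinh}\,x)$ with ${\rm Lif}_{2,k}(z)=\sum_{m\ge0}\frac{z^{2m}}{(2m)!(2m+1)^k}$ (as power series). *)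

theory Defs
  imports "HOL-Complex_Analysis.Complex_Analysis"
begin

fun stirling1_lvl2 :: "nat \<Rightarrow> nat \<Rightarrow> nat" where
  "stirling1_lvl2 0 0 = 1"
| "stirling1_lvl2 (Suc n) 0 = 0"
| "stirling1_lvl2 0 (Suc k) = 0"
| "stirling1_lvl2 (Suc n) (Suc k) = stirling1_lvl2 n k + n\<^sup>2 * stirling1_lvl2 n (Suc k)"

fun stirling2_lvl2 :: "nat \<Rightarrow> nat \<Rightarrow> nat" where
  "stirling2_lvl2 0 0 = 1"
| "stirling2_lvl2 (Suc n) 0 = 0"
| "stirling2_lvl2 0 (Suc k) = 0"
| "stirling2_lvl2 (Suc n) (Suc k) = stirling2_lvl2 n k + (Suc k)\<^sup>2 * stirling2_lvl2 n (Suc k)"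

(* The coefficient of z^(2n+1) is 1/(2n+1)^k; here i = 2n+1. *)
definition fps_Li_lvl2 :: "int \<Rightarrow> real fps" where
  "fps_Li_lvl2 k = Abs_fps (\<lambda>i. if odd i then 1 / real i powi k else 0)"

(* The coefficient of z^(2m) is 1/((2m)! (2m+1)^k); here i = 2m. *)
definition fps_Lif_lvl2 :: "int \<Rightarrow> real fps" where
  "fps_Lif_lvl2 k = Abs_fps (\<lambda>i. if even i then 1 / (fact i * real (i + 1) powi k) else 0)"

definition fps_sinh :: "'a::field_char_0 fps" where
  "fps_sinh = fps_const (1/2) * (fps_exp 1 - fps_exp (- 1))"

(* The Maclaurin series of the inverse function is the compositional inverse;
   has_fps_expansion_arsinh confirms over the complex numbers that it expands the
   library function arsinh. *)
definition fps_arsinh :: "'a::field_char_0 fps" where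
  "fps_arsinh = fps_inv fps_sinh"

lemma fps_sinh_nth_0 [simp]: "fps_nth fps_sinh 0 = 0"
  by (simp add: fps_sinh_def)

lemma fps_sinh_nth_1 [simp]: "fps_nth fps_sinh (Suc 0) = 1"
  by (simp add: fps_sinh_def)

lemma fps_arsinh_sinh: "fps_arsinh oo fps_sinh = fps_X"
  unfolding fps_arsinh_def by (rule fps_inv) simp_all

lemma fps_sinh_arsinh: "fps_sinh oo fps_arsinh = fps_X"
  unfolding fps_arsinh_def by (rule fps_inv_right) simp_all

lemma has_fps_expansion_sinh: "(sinh :: complex \<Rightarrow> complex) has_fps_expansion fps_sinh"
proof -
  have "(\<lambda>x::complex. (1/2) * (exp (1 * x) - exp ((-1) * x))) has_fps_expansion fps_sinh"
    unfolding fps_sinh_def by (intro fps_expansion_intros)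
  also have "(\<lambda>x::complex. (1/2) * (exp (1 * x) - exp ((-1) * x))) = sinh"
    by (auto simp: sinh_def scaleR_conv_of_real)
  finally show ?thesis .
qed

lemma arsinh_sinh_near_0: "eventually (\<lambda>z::complex. arsinh (sinh z) = z) (nhds 0)"
proof -
  have ev: "eventually (\<lambda>z::complex. Re (cosh z) > 0 \<and> norm z < 1) (nhds 0)"
  proof (intro eventually_conj)
    have "((\<lambda>z::complex. Re (cosh z)) \<longlongrightarrow> Re (cosh 0)) (nhds 0)"
      unfolding cosh_field_def by (intro tendsto_intros filterlim_ident) auto
    then show "eventually (\<lambda>z::complex. Re (cosh z) > 0) (nhds 0)"
      by (rule order_tendstoD) simp
    show "eventually (\<lambda>z::complex. norm z < 1) (nhds 0)"
      using eventually_nhds_in_open[of "ball 0 1" "0::complex"] by simp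
  qed
  show ?thesis
    using ev
  proof eventually_elim
    case (elim z)
    have "csqrt ((cosh z)\<^sup>2) = cosh z"
      using elim by (intro csqrt_square) auto
    moreover have "(sinh z)\<^sup>2 + 1 = (cosh z)\<^sup>2"
      by (simp add: cosh_square_eq)
    ultimately have "((sinh z)\<^sup>2 + 1) powr of_real (1/2) = cosh z"
      by (metis csqrt_conv_powr of_real_1 of_real_divide of_real_numeral)
    then have "arsinh (sinh z) = Ln (exp z)"
      by (simp add: arsinh_def sinh_plus_cosh)
    moreover have "\<bar>Im z\<bar> < 1"
      using elim abs_Im_le_cmod[of z] by linarith
    then have "Ln (exp z) = z"
      using pi_gt3 by (intro Ln_exp) auto
    ultimately show ?case by simp
  qed
qed

lemma has_fps_expansion_arsinh: "(arsinh :: complex \<Rightarrow> complex) has_fps_expansion fps_arsinh"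
proof -
  have "(arsinh :: complex \<Rightarrow> complex) analytic_on {0}"
    unfolding arsinh_def [abs_def] by (intro analytic_intros) auto
  then obtain F where F: "(arsinh :: complex \<Rightarrow> complex) has_fps_expansion F"
    using analytic_at_imp_has_fps_expansion_0 by blast
  have "(arsinh \<circ> sinh :: complex \<Rightarrow> complex) has_fps_expansion (F oo fps_sinh)"
    by (intro has_fps_expansion_compose F has_fps_expansion_sinh) simp
  moreover have "(arsinh \<circ> sinh :: complex \<Rightarrow> complex) has_fps_expansion fps_X"
    using has_fps_expansion_fps_X
    by (rule has_fps_expansion_cong[THEN iffD1, rotated 2])
      (use arsinh_sinh_near_0 in \<open>auto elim: eventually_mono\<close>)
  ultimately have "F oo fps_sinh = fps_X"
    using fps_expansion_unique_complex by blast
  then have "(F oo fps_sinh) oo fps_arsinh = fps_arsinh"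
    by (simp add: fps_arsinh_def fps_inv_def)
  moreover have "(F oo fps_sinh) oo fps_arsinh = F oo (fps_sinh oo fps_arsinh)"
    by (rule fps_compose_assoc [symmetric]) (simp_all add: fps_arsinh_def fps_inv_def)
  ultimately have "F = fps_arsinh"
    by (simp add: fps_sinh_arsinh)
  with F show ?thesis by simp
qed

(* fps_sin (1/2) is the series of sin (x/2). The series 2 sin (x/2) has subdegree 1 and divides
   the numerator, so the division of power series below is exact. *)
definition poly_bernoulli_lvl2 :: "nat \<Rightarrow> int \<Rightarrow> real" where
  "poly_bernoulli_lvl2 n k =
     fact n * fps_nth ((fps_Li_lvl2 k oo (2 * fps_sin (1/2))) / (2 * fps_sin (1/2))) n"

definition poly_cauchy_lvl2 :: "nat \<Rightarrow> int \<Rightarrow> real" where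
  "poly_cauchy_lvl2 n k = fact n * fps_nth (fps_Lif_lvl2 k oo fps_arsinh) n"

end

theory Submission
  imports Defs
begin

text \<open>
  If \<open>g'\<^sup>2 = 1 + c g\<^sup>2\<close> and \<open>g'' = c g\<close>, then \<open>D\<^sup>2\<close> maps \<open>g\<^sup>j\<close> to
  \<open>j (j - 1) g\<^bsup>j-2\<^esup> + c j\<^sup>2 g\<^sup>j\<close>. For \<open>g = 2 sin (x/2)\<close> this has \<open>c = -1/4\<close>, and the
  Stirling numbers of the first kind are the coefficients of
  \<open>D\<^sup>2 (D\<^sup>2 + 1\<^sup>2) \<dots> (D\<^sup>2 + (n-1)\<^sup>2)\<close>; applied to \<open>g\<^bsup>2j\<^esup>\<close> and evaluated at 0, this operator
  gives \<open>(2n)!\<close> if \<open>j = n\<close> and 0 otherwise. For \<open>g = sinh\<close> it has \<open>c = 1\<close>, so that the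
  recurrence shows \<open>4\<^bsup>n-m\<^esup>\<close> times the Stirling numbers of the second kind to be
  \<open>(2n)! / (2m)!\<close> times the coefficient of \<open>x\<^bsup>2n\<^esup>\<close> in \<open>sinh\<^bsup>2m\<^esup>\<close>; the second identity then
  reads off a coefficient of \<open>(Lif \<circ> arsinh) \<circ> sinh = Lif\<close>.
\<close>

section \<open>Vanishing and summation rules for the level-2 Stirling numbers\<close>

lemma stirling1_lvl2_eq_0: "n < m \<Longrightarrow> stirling1_lvl2 n m = 0"
  by (induction n m rule: stirling1_lvl2.induct) auto

lemma stirling2_lvl2_eq_0: "n < m \<Longrightarrow> stirling2_lvl2 n m = 0"
  by (induction n m rule: stirling2_lvl2.induct) auto

text \<open>With \<open>h m\<close> the value of \<open>D^(2m) f\<close> at 0, the recurrence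
  appends the operator factor \<open>D^2 + n^2\<close>. The index shift is harmless because
  \<open>n^2 * stirling1_lvl2 n m\<close> vanishes at \<open>m = 0\<close> and
  \<open>m = Suc n\<close>.\<close>

lemma sum_stirling1_lvl2_Suc:
  fixes h :: "nat \<Rightarrow> 'a::comm_semiring_1"
  shows "(\<Sum>m\<le>Suc n. of_nat (stirling1_lvl2 (Suc n) m) * h m) =
    (\<Sum>m\<le>n. of_nat (stirling1_lvl2 n m) * (h (Suc m) + of_nat n ^ 2 * h m))"
proof -
  have "(\<Sum>m\<le>n. of_nat (n\<^sup>2 * stirling1_lvl2 n (Suc m)) * h (Suc m)) =
      (\<Sum>m\<le>Suc n. of_nat (n\<^sup>2 * stirling1_lvl2 n m) * h m)"
    unfolding sum.atMost_Suc_shift by (cases n) auto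
  also have "\<dots> = (\<Sum>m\<le>n. of_nat (n\<^sup>2 * stirling1_lvl2 n m) * h m)"
    by (simp add: stirling1_lvl2_eq_0)
  finally show ?thesis
    unfolding sum.atMost_Suc_shift
    by (simp add: sum.distrib algebra_simps)
qed

section \<open>Second derivatives of powers\<close>

lemma fact_mult_fps_nth_deriv2:
  fixes f :: "'a::field_char_0 fps"
  shows "fact (n + 2) * fps_nth f (n + 2) = fact n * fps_nth (fps_deriv (fps_deriv f)) n"
  by (simp add: algebra_simps)

lemma fps_deriv2_power:
  fixes g :: "'a::field_char_0 fps"
  assumes "fps_deriv g ^ 2 = 1 + fps_const c * g ^ 2"
    and "fps_deriv (fps_deriv g) = fps_const c * g"
  shows "fps_deriv (fps_deriv (g ^ (j + 2))) =
    fps_const (of_nat ((j + 2) * (j + 1))) * g ^ j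
    + fps_const (c * of_nat (j + 2) ^ 2) * g ^ (j + 2)"
proof -
  have power: "fps_deriv (g ^ (m + 1)) = of_nat (m + 1) * (fps_deriv g * g ^ m)" for m
    by (simp add: fps_deriv_power fps_of_nat mult_ac del: of_nat_Suc power_Suc)
  have "fps_deriv (fps_deriv (g ^ (j + 2))) =
      of_nat (j + 2) * (fps_deriv (fps_deriv g) * g ^ (j + 1)
        + fps_deriv g * fps_deriv (g ^ (j + 1)))"
    using power[of "j + 1"] by (simp add: add.commute del: of_nat_Suc power_Suc)
  also have "\<dots> = of_nat (j + 2) * (fps_deriv (fps_deriv g) * g ^ (j + 1)
        + of_nat (j + 1) * g ^ j * fps_deriv g ^ 2)"
    unfolding power by (simp only: power2_eq_square mult_ac)
  also have "\<dots> = of_nat (j + 2) * (fps_const c * g * g ^ (j + 1)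
        + of_nat (j + 1) * g ^ j * (1 + fps_const c * g ^ 2))"
    by (simp only: assms)
  also have "\<dots> = of_nat ((j + 2) * (j + 1)) * g ^ j
      + fps_const c * of_nat (j + 2) ^ 2 * g ^ (j + 2)"
    by (simp add: algebra_simps power2_eq_square)
  also have "fps_const c * of_nat (j + 2) ^ 2 = fps_const (c * of_nat (j + 2) ^ 2)"
    by (simp only: fps_of_nat[symmetric] fps_const_mult fps_const_power)
  finally show ?thesis
    by (simp only: fps_of_nat)
qed

lemma fact_mult_fps_nth_power_add2:
  fixes g :: "'a::field_char_0 fps"
  assumes "fps_deriv g ^ 2 = 1 + fps_const c * g ^ 2"
    and "fps_deriv (fps_deriv g) = fps_const c * g"
  shows "fact (n + 2) * fps_nth (g ^ (j + 2)) (n + 2) =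
    of_nat ((j + 2) * (j + 1)) * (fact n * fps_nth (g ^ j) n)
    + c * of_nat (j + 2) ^ 2 * (fact n * fps_nth (g ^ (j + 2)) n)"
  unfolding fact_mult_fps_nth_deriv2 fps_deriv2_power[OF assms]
  by (simp add: ring_distribs mult.assoc mult.left_commute[of "fact n"]
      del: of_nat_add of_nat_Suc of_nat_mult power_Suc add_2_eq_Suc' fact_Suc)

section \<open>The series of 2 sin (x/2) and the first identity\<close>

definition fps_2sin_half :: "real fps" where
  "fps_2sin_half = 2 * fps_sin (1/2)"

lemma fps_2sin_half_nth_0 [simp]: "fps_nth fps_2sin_half 0 = 0"
  by (simp add: fps_2sin_half_def numeral_fps_const)

lemma fps_2sin_half_nonzero: "fps_2sin_half \<noteq> 0"
proof
  assume "fps_2sin_half = 0"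
  then have "fps_nth fps_2sin_half 1 = 0" by simp
  then show False by (simp add: fps_2sin_half_def numeral_fps_const fps_sin_def)
qed

lemma fps_deriv_2sin_half: "fps_deriv fps_2sin_half = fps_cos (1/2)"
  by (simp add: fps_2sin_half_def numeral_fps_const fps_sin_deriv flip: mult.assoc)

lemma fps_deriv2_2sin_half:
  "fps_deriv (fps_deriv fps_2sin_half) = fps_const (- 1/4) * fps_2sin_half"
  unfolding fps_deriv_2sin_half
  by (simp add: fps_2sin_half_def numeral_fps_const fps_cos_deriv flip: mult.assoc fps_const_neg)

lemma fps_deriv_2sin_half_square:
  "fps_deriv fps_2sin_half ^ 2 = 1 + fps_const (- 1/4) * fps_2sin_half ^ 2"
proof -
  have "fps_cos (1/2) ^ 2 = 1 - fps_sin (1/2 :: real) ^ 2"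
    using fps_sin_cos_sum_of_squares[of "1/2::real"] by (simp add: algebra_simps)
  moreover have "fps_const (- 1/4) * fps_2sin_half ^ 2 = - (fps_sin (1/2) ^ 2)"
    by (simp add: fps_2sin_half_def numeral_fps_const power_mult_distrib fps_const_power
        flip: mult.assoc fps_const_neg)
  ultimately show ?thesis
    by (simp add: fps_deriv_2sin_half)
qed

lemma sum_stirling1_lvl2_2sin_half_power:
  "(\<Sum>m\<le>n. real (stirling1_lvl2 n m) * (fact (2 * m) * fps_nth (fps_2sin_half ^ (2 * j)) (2 * m)))
    = (if j = n then fact (2 * n) else 0)"
proof (induction n arbitrary: j)
  case 0
  then show ?case by (cases j) auto
next
  case (Suc n)
  let ?t = "\<lambda>j m. fact (2 * m) * fps_nth (fps_2sin_half ^ (2 * j)) (2 * m)"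
  show ?case
  proof (cases j)
    case 0
    \<comment> \<open>The power is the constant series 1, so only \<open>m = 0\<close> could
      contribute, and there the Stirling number is 0.\<close>
    have "(\<Sum>m\<le>Suc n. real (stirling1_lvl2 (Suc n) m) * ?t 0 m) = 0"
      by (intro sum.neutral ballI) (metis Zero_not_Suc fps_one_nth mult_eq_0_iff mult_zero_right
          not0_implies_Suc of_nat_0 power_0 stirling1_lvl2.simps(2) zero_neq_numeral)
    with 0 show ?thesis by simp
  next
    case (Suc i)
    \<comment> \<open>As \<open>c = - 1/4\<close>, the term \<open>c * (2 * i + 2)^2\<close> becomes
      \<open>- (Suc i)^2\<close>.\<close>
    have "?t (Suc i) (Suc m) = real ((2 * i + 2) * (2 * i + 1)) * ?t i m
        - real (Suc i) ^ 2 * ?t (Suc i) m" for m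
      using fact_mult_fps_nth_power_add2[OF fps_deriv_2sin_half_square fps_deriv2_2sin_half,
          of "2 * m" "2 * i"]
      by (simp add: power2_eq_square algebra_simps del: power_Suc)
    then have "(\<Sum>m\<le>Suc n. real (stirling1_lvl2 (Suc n) m) * ?t (Suc i) m) =
        (\<Sum>m\<le>n. real ((2 * i + 2) * (2 * i + 1)) * (real (stirling1_lvl2 n m) * ?t i m)
          + (real n ^ 2 - real (Suc i) ^ 2) * (real (stirling1_lvl2 n m) * ?t (Suc i) m))"
      unfolding sum_stirling1_lvl2_Suc
      by (intro sum.cong refl) (simp only: ring_distribs mult_ac diff_conv_add_uminus minus_mult_right)
    also have "\<dots> = real ((2 * i + 2) * (2 * i + 1)) * (if i = n then fact (2 * n) else 0)
        + (real n ^ 2 - real (Suc i) ^ 2) * (if Suc i = n then fact (2 * n) else 0)"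
      by (simp only: sum.distrib Suc.IH flip: sum_distrib_left)
    \<comment> \<open>For \<open>i = n\<close> the factors complete \<open>(2 * n)!\<close> to
      \<open>(2 * n + 2)!\<close>; for \<open>Suc i = n\<close> the difference of squares is
      0.\<close>
    also have "\<dots> = (if Suc i = Suc n then fact (2 * Suc n) else 0)"
      by (auto simp: algebra_simps)
    finally show ?thesis using Suc by simp
  qed
qed

text \<open>Only odd exponents occur in \<open>fps_Li_lvl2 k\<close>, so a factor
  \<open>fps_X\<close> splits off; composition turns it into \<open>fps_2sin_half\<close>, which
  cancels.\<close>

lemma fps_Li_lvl2_compose_div:
  "(fps_Li_lvl2 k oo fps_2sin_half) / fps_2sin_half =
    Abs_fps (\<lambda>i. if even i then 1 / real (i + 1) powi k else 0) oo fps_2sin_half"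
proof -
  have "fps_Li_lvl2 k = fps_X * Abs_fps (\<lambda>i. if even i then 1 / real (i + 1) powi k else 0)"
    by (rule fps_ext) (auto simp: fps_Li_lvl2_def)
  then show ?thesis
    by (simp add: fps_compose_mult_distrib fps_2sin_half_nonzero)
qed

lemma sum_even_support:
  fixes f :: "nat \<Rightarrow> 'a::comm_monoid_add"
  assumes "\<And>i. odd i \<Longrightarrow> f i = 0"
  shows "(\<Sum>i\<le>2 * n. f i) = (\<Sum>j\<le>n. f (2 * j))"
  by (induction n) (simp_all add: assms)

text \<open>Powers \<open>g ^ i\<close> with \<open>i > n\<close> have no coefficient of index
  \<open>n\<close>. A bound \<open>N\<close> shared by all \<open>n\<close> allows sums to be
  exchanged.\<close>

lemma fps_compose_nth_le:
  assumes "fps_nth g 0 = 0" "n \<le> N"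
  shows "fps_nth (f oo g) n = (\<Sum>i\<le>N. fps_nth f i * fps_nth (g ^ i) n)"
  unfolding fps_compose_nth atLeast0AtMost
  by (rule sum.mono_neutral_left) (use assms startsby_zero_power_prefix[of g] in auto)

lemma sum_stirling1_poly_bernoulli_lvl2:
  "(\<Sum>m\<le>n. real (stirling1_lvl2 n m) * poly_bernoulli_lvl2 (2 * m) k) =
    fact (2 * n) / real (2 * n + 1) powi k"
proof -
  let ?t = "\<lambda>j m. fact (2 * m) * fps_nth (fps_2sin_half ^ (2 * j)) (2 * m)"
  have "poly_bernoulli_lvl2 (2 * m) k = (\<Sum>j\<le>n. 1 / real (2 * j + 1) powi k * ?t j m)"
    if "m \<le> n" for m
  proof -
    have "poly_bernoulli_lvl2 (2 * m) k = fact (2 * m) *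
        (\<Sum>j\<le>n. 1 / real (2 * j + 1) powi k * fps_nth (fps_2sin_half ^ (2 * j)) (2 * m))"
      unfolding poly_bernoulli_lvl2_def fps_2sin_half_def[symmetric] fps_Li_lvl2_compose_div
      using that by (subst fps_compose_nth_le[of _ _ "2 * n"]) (simp_all add: sum_even_support)
    then show ?thesis
      by (simp add: sum_distrib_left mult_ac)
  qed
  then have "(\<Sum>m\<le>n. real (stirling1_lvl2 n m) * poly_bernoulli_lvl2 (2 * m) k) =
      (\<Sum>m\<le>n. \<Sum>j\<le>n. 1 / real (2 * j + 1) powi k * (real (stirling1_lvl2 n m) * ?t j m))"
    by (intro sum.cong refl) (simp add: sum_distrib_left mult_ac)
  \<comment> \<open>After the exchange the inner sum over \<open>m\<close> is the orthogonality
    relation for powers of 2 sin (x/2).\<close>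
  also have "\<dots> = (\<Sum>j\<le>n. 1 / real (2 * j + 1) powi k * (if j = n then fact (2 * n) else 0))"
    by (subst sum.swap)
      (simp only: sum_stirling1_lvl2_2sin_half_power flip: sum_distrib_left)
  also have "\<dots> = (\<Sum>j\<le>n. if j = n then fact (2 * n) / real (2 * n + 1) powi k else 0)"
    by (intro sum.cong) auto
  finally show ?thesis by simp
qed

section \<open>Powers of sinh and the second identity\<close>

lemma fps_deriv2_sinh: "fps_deriv (fps_deriv fps_sinh) = fps_const 1 * fps_sinh"
  by (simp add: fps_sinh_def flip: fps_const_neg)

lemma fps_deriv_sinh_square: "fps_deriv fps_sinh ^ 2 = 1 + fps_const 1 * fps_sinh ^ 2"
proof -
  have "fps_exp 1 * fps_exp (- 1) = (1 :: 'a fps)"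
    by (simp flip: fps_exp_add_mult)
  moreover have "fps_const (1/2) ^ 2 * 4 = (1 :: 'a fps)"
    by (simp add: numeral_fps_const fps_const_power power2_eq_square)
  moreover have "fps_deriv fps_sinh = fps_const (1/2) * (fps_exp 1 + fps_exp (- 1) :: 'a fps)"
    by (simp add: fps_sinh_def flip: fps_const_neg)
  ultimately show ?thesis
    unfolding fps_sinh_def fps_const_1_eq_1 by algebra
qed

text \<open>Odd powers of sinh are odd functions. Exponent 1 is treated apart since the recurrence
  requires exponent at least 2.\<close>

lemma fps_sinh_power_nth_odd:
  "odd i \<Longrightarrow> fps_nth (fps_sinh ^ i :: 'a::field_char_0 fps) (2 * n) = 0"
proof (induction n arbitrary: i)
  case 0
  then show ?case by (simp add: fps_power_zeroth odd_pos)
next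
  case (Suc n)
  consider "i = 1" | j where "i = j + 2" "odd j"
    using Suc.prems by (metis One_nat_def add_2_eq_Suc' even_Suc even_zero not0_implies_Suc)
  then have "fact (2 * n + 2) * fps_nth (fps_sinh ^ i :: 'a fps) (2 * n + 2) = 0"
  proof cases
    case 1
    then show ?thesis
      unfolding fact_mult_fps_nth_deriv2 using Suc.IH[of 1] by (simp add: fps_deriv2_sinh)
  next
    case 2
    then show ?thesis
      using fact_mult_fps_nth_power_add2[OF fps_deriv_sinh_square fps_deriv2_sinh,
          of "2 * n" j, where 'a = 'a]
        Suc.IH[of j] Suc.IH[of i] by simp
  qed
  then show ?case by (simp del: fact_Suc)
qed

lemma fps_sinh_power_nth_even:
  "fact (2 * n) * fps_nth (fps_sinh ^ (2 * m) :: 'a::field_char_0 fps) (2 * n) =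
    of_nat (stirling2_lvl2 n m) * 4 ^ (n - m) * fact (2 * m)"
proof (induction n arbitrary: m)
  case 0
  then show ?case by (cases m) (simp_all add: fps_power_zeroth)
next
  case (Suc n)
  show ?case
  proof (cases m)
    case 0
    then show ?thesis by simp
  next
    case (Suc i)
    \<comment> \<open>For \<open>n \<le> i\<close> the subtraction truncates and the exponents fail
      to match, but then the Stirling number is 0.\<close>
    have pow: "(4::'a) * (of_nat (stirling2_lvl2 n (Suc i)) * 4 ^ (n - Suc i)) =
        of_nat (stirling2_lvl2 n (Suc i)) * 4 ^ (n - i)"
    proof (cases "i < n")
      case True
      then have "n - i = Suc (n - Suc i)" by simp
      then show ?thesis by simp
    next
      case False
      then show ?thesis by (simp add: stirling2_lvl2_eq_0)
    qed
    have "fact (2 * Suc n) * fps_nth (fps_sinh ^ (2 * Suc i) :: 'a fps) (2 * Suc n) =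
        of_nat ((2 * i + 2) * (2 * i + 1)) * (of_nat (stirling2_lvl2 n i) * 4 ^ (n - i) * fact (2 * i))
        + of_nat (2 * i + 2) ^ 2 *
          (of_nat (stirling2_lvl2 n (Suc i)) * 4 ^ (n - Suc i) * fact (2 * Suc i))"
      using fact_mult_fps_nth_power_add2[OF fps_deriv_sinh_square fps_deriv2_sinh,
          of "2 * n" "2 * i", where 'a = 'a]
      unfolding Suc.IH[symmetric] by simp
    also have "of_nat ((2 * i + 2) * (2 * i + 1)) *
        (of_nat (stirling2_lvl2 n i) * 4 ^ (n - i) * fact (2 * i)) =
        of_nat (stirling2_lvl2 n i) * 4 ^ (n - i) * (fact (2 * Suc i) :: 'a)"
      by (simp add: algebra_simps)
    \<comment> \<open>The powers of 4 arise here, from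
      \<open>(2 * i + 2)^2 = 4 * (Suc i)^2\<close>.\<close>
    also have "of_nat (2 * i + 2) ^ 2 *
        (of_nat (stirling2_lvl2 n (Suc i)) * 4 ^ (n - Suc i) * fact (2 * Suc i)) =
        of_nat (Suc i) ^ 2 * (4 * (of_nat (stirling2_lvl2 n (Suc i)) * 4 ^ (n - Suc i)))
          * (fact (2 * Suc i) :: 'a)"
      by (simp add: power2_eq_square algebra_simps del: fact_Suc)
    finally show ?thesis
      unfolding Suc pow by (simp add: algebra_simps del: fact_Suc of_nat_Suc)
  qed
qed

lemma sum_stirling2_poly_cauchy_lvl2:
  "(\<Sum>m\<le>n. real (stirling2_lvl2 n m) * 4 ^ (n - m) * poly_cauchy_lvl2 (2 * m) k) =
    1 / real (2 * n + 1) powi k"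
proof -
  let ?F = "fps_Lif_lvl2 k oo fps_arsinh"
  have "?F oo fps_sinh = fps_Lif_lvl2 k oo (fps_arsinh oo fps_sinh)"
    by (rule fps_compose_assoc[symmetric]) (simp_all add: fps_arsinh_def fps_inv_def)
  then have F: "?F oo fps_sinh = fps_Lif_lvl2 k"
    by (simp add: fps_arsinh_sinh)
  have "(\<Sum>m\<le>n. real (stirling2_lvl2 n m) * 4 ^ (n - m) * poly_cauchy_lvl2 (2 * m) k) =
      (\<Sum>m\<le>n. fps_nth ?F (2 * m) * (real (stirling2_lvl2 n m) * 4 ^ (n - m) * fact (2 * m)))"
    by (simp add: poly_cauchy_lvl2_def mult_ac)
  also have "\<dots> = fact (2 * n) * (\<Sum>m\<le>n. fps_nth ?F (2 * m) * fps_nth (fps_sinh ^ (2 * m)) (2 * n))"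
    unfolding fps_sinh_power_nth_even[symmetric] by (simp add: sum_distrib_left mult_ac)
  \<comment> \<open>Odd powers of sinh have no coefficient of even index, so the odd coefficients of
    \<open>?F\<close> drop out.\<close>
  also have "(\<Sum>m\<le>n. fps_nth ?F (2 * m) * fps_nth (fps_sinh ^ (2 * m)) (2 * n)) =
      (\<Sum>i\<le>2 * n. fps_nth ?F i * fps_nth (fps_sinh ^ i) (2 * n))"
    by (rule sum_even_support[symmetric]) (simp add: fps_sinh_power_nth_odd)
  also have "\<dots> = fps_nth (?F oo fps_sinh) (2 * n)"
    by (simp add: fps_compose_nth atLeast0AtMost)
  finally show ?thesis
    unfolding F by (simp add: fps_Lif_lvl2_def)
qed

theorem theorem9:
  fixes n :: nat and k :: int
  assumes "n \<ge> 1"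
  shows "1 / fact (2 * n) * (\<Sum>m=0..n. real (stirling1_lvl2 n m) * poly_bernoulli_lvl2 (2 * m) k)
           = 1 / real (2 * n + 1) powi k
       \<and> (\<Sum>m=0..n. real (stirling2_lvl2 n m) * 4 ^ (n - m) * poly_cauchy_lvl2 (2 * m) k)
           = 1 / real (2 * n + 1) powi k"
  unfolding atLeast0AtMost sum_stirling1_poly_bernoulli_lvl2 sum_stirling2_poly_cauchy_lvl2
  by simp

end
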